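(* Suppose that $S\neq\varnothing$. Let $(t_k)_{k\in\mathbb{N}}$ be a sequence of strictly positive real numbers and set $\alpha_k:=\frac{t_k-1}{t_{k+1}}$ for every $k\in\mathbb{N}$. Let $x_0\in X$, set $r_0:=0\in X$, and for every $k\in\mathbb{N}$ set $$x_{k+1}:=T(x_k+r_k),\qquad r_{k+1}:=\alpha_k(x_{k+1}-x_k).$$ Suppose that the sequence $(x_k)_{k\in\mathbb{N}}$ is bounded and that all its weak cluster points lie in $S$. Then $(x_k)_{k\in\mathbb{N}}$ converges weakly to $P_Sx_0$.
   Context: $X$ and $Y$ are real Hilbert spaces, $A:X\to Y$ is linear and continuous, $b\in Y$, and $U$ is a (nonempty) closed affine subspace of $X$. For a nonempty closed convex set $C\subseteq X$, $P_C$ denotes the orthogonal projection onto $C$ and $\iota_C$ the indicator function of $C$ ($0$ on $C$, $+\infty$ elsewhere). Consider minimizing $\tfrac12\|Ax-b\|^2$ subject to $x\in U$; set $f:=\tfrac12\|A(\cdot)-b\|^2$, $g:=\iota_U$, $F:=f+g$, and let $S:=\operatorname{argmin}F$ be the set of minimizers of $F$ over $X$. Set $\beta:=\|A^*A\|$, assumed to be strictly positive, and let $T:X\to X$ be the proximal-gradient operator $$T:=P_U\bigl(\mathrm{Id}-\tfrac1\beta A^*(A(\cdot)-b)\bigr).$$ *)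

theory Defs
  imports "HOL-Analysis.Analysis"
begin

text \<open>
  Real Hilbert spaces are the types of sort \<open>{real_inner, complete_space}\<close>. On such types
  \<^const>\<open>adjoint\<close> of a bounded linear map is the Hilbert space adjoint: it is characterised by
  \<open>A x \<bullet> y = x \<bullet> adjoint A y\<close>, and it exists by the Riesz representation theorem.
\<close>

text \<open>
  \<^const>\<open>closest_point\<close> requires a Heine--Borel space, which excludes infinite dimension; this is
  the same definition without that restriction. The choice is meaningful (and
  unique) when \<open>C\<close> is nonempty, closed and convex and the space is complete.
\<close>

definition proj :: "'a::real_inner set \<Rightarrow> 'a \<Rightarrow> 'a" where
  "proj C a = (SOME p. p \<in> C \<and> (\<forall>y\<in>C. dist a p \<le> dist a y))"

definition indicator_fun :: "'a set \<Rightarrow> 'a \<Rightarrow> ereal" where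
  "indicator_fun C x = (if x \<in> C then 0 else \<infinity>)"

definition argmin :: "('a \<Rightarrow> ereal) \<Rightarrow> 'a set" where
  "argmin F = {x. \<forall>y. F x \<le> F y}"

text \<open>
  The coarsest topology making every functional \<open>x \<mapsto> x \<bullet> u\<close> continuous; on a Hilbert
  space these are exactly the continuous linear functionals.
\<close>

definition weak_topology :: "'a::real_inner topology" where
  "weak_topology = topology_generated_by {(\<lambda>x. x \<bullet> u) -` V | u V. open V}"

text \<open>
  Cluster points are taken in the sequential sense. For bounded sequences in a Hilbert space this
  agrees with the topological sense, the weak topology being metrizable on bounded subsets of
  the closed linear span of a sequence.
\<close>

definition weak_cluster_point :: "(nat \<Rightarrow> 'a::real_inner) \<Rightarrow> 'a \<Rightarrow> bool" where
  "weak_cluster_point x p \<longleftrightarrow>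
     (\<exists>\<sigma>. strict_mono \<sigma> \<and> limitin weak_topology (x \<circ> \<sigma>) p sequentially)"

lemma topspace_weak_topology [simp]: "topspace weak_topology = UNIV"
proof -
  have "UNIV \<in> {(\<lambda>x::'a. x \<bullet> u) -` V | u V. open V}"
    by (rule CollectI, rule exI[of _ 0], rule exI[of _ UNIV]) auto
  then show ?thesis
    unfolding weak_topology_def topology_generated_by_topspace by blast
qed

lemma limitin_weak_topology_iff:
  "limitin weak_topology f l F \<longleftrightarrow> (\<forall>u. ((\<lambda>k. f k \<bullet> u) \<longlongrightarrow> l \<bullet> u) F)"
proof
  assume L: "limitin weak_topology f l F"
  show "\<forall>u. ((\<lambda>k. f k \<bullet> u) \<longlongrightarrow> l \<bullet> u) F"
  proof (intro allI topological_tendstoI)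
    fix u V assume V: "open V" "l \<bullet> u \<in> V"
    have "openin weak_topology ((\<lambda>x. x \<bullet> u) -` V)"
      unfolding weak_topology_def by (rule topology_generated_by_Basis) (use V in blast)
    then have "eventually (\<lambda>k. f k \<in> (\<lambda>x. x \<bullet> u) -` V) F"
      using L V unfolding limitin_def by auto
    then show "eventually (\<lambda>k. f k \<bullet> u \<in> V) F" by simp
  qed
next
  assume R: "\<forall>u. ((\<lambda>k. f k \<bullet> u) \<longlongrightarrow> l \<bullet> u) F"
  have "l \<in> W \<longrightarrow> eventually (\<lambda>k. f k \<in> W) F"
    if "generate_topology_on {(\<lambda>x. x \<bullet> u) -` V | u V. open V} W" for W
    using that
  proof (induction rule: generate_topology_on.induct)
    case (Int a b)
    then show ?case by (auto intro: eventually_conj)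
  next
    case (UN K)
    then show ?case by (blast intro: eventually_mono)
  next
    case (Basis s)
    then obtain u V where V: "open V" and s: "s = (\<lambda>x. x \<bullet> u) -` V" by blast
    show ?case using topological_tendstoD[OF R[rule_format, of u] V] s by simp
  qed auto
  then have "\<forall>W. openin weak_topology W \<and> l \<in> W \<longrightarrow> eventually (\<lambda>k. f k \<in> W) F"
    by (simp add: weak_topology_def openin_topology_generated_by_iff)
  then show "limitin weak_topology f l F"
    unfolding limitin_def by simp
qed

end

theory Submission
  imports Defs "HOL-Complex_Analysis.Great_Picard"
begin

text \<open>
  Let \<open>K\<close> be the intersection of the direction space of \<open>U\<close> with the kernel of \<open>A\<close>. The
  gradient step moves orthogonally to \<open>ker A\<close> and \<open>P\<^sub>U\<close> moves orthogonally to the directions of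
  \<open>U\<close>, so \<open>T z - z\<close> is orthogonal to \<open>K\<close>. As \<open>r\<^sub>0 = 0\<close> and each later \<open>r\<^sub>k\<close> is a multiple of
  the preceding increment, all increments of \<open>x\<close> are orthogonal to \<open>K\<close>, and hence so is
  \<open>p - x\<^sub>0\<close> for every weak cluster point \<open>p\<close>. Since \<open>S\<close> is a translate of \<open>K\<close>, a cluster point in
  \<open>S\<close> is \<open>P\<^sub>S x\<^sub>0\<close>, and a bounded sequence with a single weak cluster point converges weakly.
\<close>

section \<open>Projections onto closed convex sets\<close>

text \<open>A minimizing sequence is Cauchy: midpoints of its terms stay in the convex set
  \<open>C\<close>, so the parallelogram identity bounds the gaps between terms. Completeness gives
  a limit, and closedness keeps it in \<open>C\<close>.\<close>

lemma closest_point_exists_complete: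
  fixes C :: "'a::{real_inner, complete_space} set"
  assumes "convex C" "closed C" "C \<noteq> {}"
  obtains p where "p \<in> C" "\<And>y. y \<in> C \<Longrightarrow> dist a p \<le> dist a y"
proof -
  define D where "D = (INF c\<in>C. (dist a c)\<^sup>2)"
  have bdd: "bdd_below ((\<lambda>c. (dist a c)\<^sup>2) ` C)"
    by (rule bdd_belowI2[of _ 0]) simp
  have D_le: "D \<le> (dist a c)\<^sup>2" if "c \<in> C" for c
    unfolding D_def by (rule cINF_lower[OF bdd that])
  have "\<exists>c\<in>C. (dist a c)\<^sup>2 < D + inverse (real (Suc n))" for n
    using cINF_less_iff[OF \<open>C \<noteq> {}\<close> bdd, of "D + inverse (real (Suc n))"]
    unfolding D_def by simp
  then obtain c where c: "\<And>n. c n \<in> C"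
    and c_less: "\<And>n. (dist a (c n))\<^sup>2 < D + inverse (real (Suc n))"
    by metis
  have gap: "(dist (c m) (c n))\<^sup>2 \<le> 2 * inverse (real (Suc m)) + 2 * inverse (real (Suc n))" for m n
  proof -
    have "(1/2) *\<^sub>R c m + (1/2) *\<^sub>R c n \<in> C"
      using convexD[OF \<open>convex C\<close> c c, of "1/2" "1/2"] by simp
    then have "D \<le> (dist a ((1/2) *\<^sub>R c m + (1/2) *\<^sub>R c n))\<^sup>2"
      by (rule D_le)
    \<comment> \<open>Parallelogram identity for \<open>a - c m\<close> and \<open>a - c n\<close>.
      The midpoint term removes at least \<open>4 * D\<close>, which cancels the copies of
      \<open>D\<close> in the bounds on the other two terms.\<close>
    moreover have "(dist (c m) (c n))\<^sup>2 = 2 * (dist a (c m))\<^sup>2 + 2 * (dist a (c n))\<^sup>2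
        - 4 * (dist a ((1/2) *\<^sub>R c m + (1/2) *\<^sub>R c n))\<^sup>2"
      unfolding dist_norm power2_norm_eq_inner
      by (simp add: inner_simps inner_commute algebra_simps)
    ultimately show ?thesis
      using c_less[of m] c_less[of n] by linarith
  qed
  have "Cauchy c"
  proof (rule metric_CauchyI)
    fix e :: real assume "0 < e"
    \<comment> \<open>With this threshold the two terms of \<open>gap\<close> are each below
      \<open>e\<^sup>2 / 2\<close>.\<close>
    then obtain N where N: "inverse (real (Suc N)) < e\<^sup>2 / 4"
      using reals_Archimedean[of "e\<^sup>2 / 4"] by auto
    have "dist (c m) (c n) < e" if "N \<le> m" "N \<le> n" for m n
    proof -
      have "inverse (real (Suc m)) \<le> inverse (real (Suc N))"
        "inverse (real (Suc n)) \<le> inverse (real (Suc N))"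
        using that by (auto intro: le_imp_inverse_le)
      then have "(dist (c m) (c n))\<^sup>2 < e\<^sup>2"
        using gap[of m n] N by linarith
      then show ?thesis
        using \<open>0 < e\<close> by (meson less_imp_le power_less_imp_less_base)
    qed
    then show "\<exists>M. \<forall>m\<ge>M. \<forall>n\<ge>M. dist (c m) (c n) < e"
      by blast
  qed
  then obtain p where p: "c \<longlonglongrightarrow> p"
    using Cauchy_convergent_iff convergent_def by blast
  have "p \<in> C"
    using \<open>closed C\<close> c p closed_sequentially by blast
  have "(\<lambda>n. (dist a (c n))\<^sup>2) \<longlonglongrightarrow> (dist a p)\<^sup>2"
    by (intro tendsto_intros p)
  moreover have "(\<lambda>n. D + inverse (real (Suc n))) \<longlonglongrightarrow> D + 0"
    by (intro tendsto_intros LIMSEQ_inverse_real_of_nat)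
  ultimately have "(dist a p)\<^sup>2 \<le> D + 0"
    by (rule LIMSEQ_le) (use c_less less_imp_le in blast)
  then have "dist a p \<le> dist a y" if "y \<in> C" for y
    using D_le[OF that] by (simp add: power2_le_imp_le)
  with \<open>p \<in> C\<close> show thesis
    by (rule that)
qed

lemma proj_in_and_le:
  fixes C :: "'a::{real_inner, complete_space} set"
  assumes "convex C" "closed C" "C \<noteq> {}"
  shows proj_in: "proj C a \<in> C"
    and proj_le: "y \<in> C \<Longrightarrow> dist a (proj C a) \<le> dist a y"
proof -
  obtain p where "p \<in> C" "\<And>y. y \<in> C \<Longrightarrow> dist a p \<le> dist a y"
    using closest_point_exists_complete[OF assms] by blast
  then have "\<exists>p. p \<in> C \<and> (\<forall>y\<in>C. dist a p \<le> dist a y)"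
    by blast
  from someI_ex[OF this]
  show "proj C a \<in> C" "y \<in> C \<Longrightarrow> dist a (proj C a) \<le> dist a y"
    unfolding proj_def by auto
qed

lemma affine_add_diff:
  assumes "affine U" "p \<in> U" "u \<in> U" "v \<in> U"
  shows "p + s *\<^sub>R (u - v) \<in> U"
proof -
  have "p + s *\<^sub>R (u - v) = p + s *\<^sub>R u + (- s) *\<^sub>R v"
    by (simp add: algebra_simps)
  moreover have "1 *\<^sub>R p + s *\<^sub>R u + (- s) *\<^sub>R v \<in> U"
    by (rule mem_affine_3[OF assms]) simp
  ultimately show ?thesis by (simp only: scaleR_one)
qed

text \<open>If the residual had a component along a direction of \<open>U\<close>, moving from the
  projection along that direction would stay in \<open>U\<close> and come strictly closer to
  \<open>a\<close>.\<close>

lemma proj_affine_orthogonal: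
  fixes U :: "'a::{real_inner, complete_space} set"
  assumes "affine U" "closed U" "u \<in> U" "v \<in> U"
  shows "(a - proj U a) \<bullet> (u - v) = 0"
proof (rule ccontr)
  define q where "q = a - proj U a"
  define w where "w = u - v"
  assume "(a - proj U a) \<bullet> (u - v) \<noteq> 0"
  then have qw: "q \<bullet> w \<noteq> 0" by (simp add: q_def w_def)
  then have w: "w \<bullet> w > 0" by auto
  have U: "convex U" "U \<noteq> {}"
    using assms affine_imp_convex by auto
  \<comment> \<open>This is the minimizer of the quadratic
    \<open>s \<mapsto> (norm (q - s *\<^sub>R w))\<^sup>2\<close>.\<close>
  define s where "s = (q \<bullet> w) / (w \<bullet> w)"
  have "proj U a + s *\<^sub>R w \<in> U"
    unfolding w_def using assms U by (intro affine_add_diff proj_in)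
  then have "dist a (proj U a) \<le> dist a (proj U a + s *\<^sub>R w)"
    using U assms by (intro proj_le)
  then have "(norm q)\<^sup>2 \<le> (norm (q - s *\<^sub>R w))\<^sup>2"
    by (simp add: dist_norm q_def algebra_simps)
  also have "\<dots> = (norm q)\<^sup>2 - 2 * s * (q \<bullet> w) + s * s * (w \<bullet> w)"
    unfolding power2_norm_eq_inner by (simp add: inner_simps inner_commute algebra_simps)
  also have "\<dots> = (norm q)\<^sup>2 - (q \<bullet> w)\<^sup>2 / (w \<bullet> w)"
    using w by (simp add: s_def field_simps power2_eq_square)
  finally have "(q \<bullet> w)\<^sup>2 / (w \<bullet> w) \<le> 0" by simp
  moreover have "(q \<bullet> w)\<^sup>2 / (w \<bullet> w) > 0"
    using w qw by simp
  ultimately show False by simp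
qed

text \<open>The residuals at \<open>p\<close> and at \<open>proj U a\<close> are both orthogonal to
  \<open>proj U a - p\<close>, which is their difference and hence zero. This identifies the point
  selected by \<open>SOME\<close>.\<close>

lemma proj_affine_eqI:
  fixes U :: "'a::{real_inner, complete_space} set"
  assumes "affine U" "closed U" "p \<in> U" and orth: "\<And>u. u \<in> U \<Longrightarrow> (a - p) \<bullet> (u - p) = 0"
  shows "proj U a = p"
proof -
  have q: "proj U a \<in> U"
    using assms affine_imp_convex by (intro proj_in) auto
  have "(proj U a - p) \<bullet> (proj U a - p)
      = (a - p) \<bullet> (proj U a - p) - (a - proj U a) \<bullet> (proj U a - p)"
    by (simp add: inner_diff_left)
  also have "\<dots> = 0"
    using orth[OF q] proj_affine_orthogonal[OF assms(1,2) q assms(3)] by simp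
  finally show ?thesis by simp
qed

section \<open>Riesz representation and adjoints\<close>

text \<open>For nonzero \<open>\<phi>\<close>, the point \<open>p\<close> of least norm in the
  hyperplane \<open>\<phi> = 1\<close> is orthogonal to the kernel of \<open>\<phi>\<close>, so a
  multiple of \<open>p\<close> represents \<open>\<phi>\<close>.\<close>

lemma Riesz_representation:
  fixes \<phi> :: "'a::{real_inner, complete_space} \<Rightarrow> real"
  assumes "bounded_linear \<phi>"
  obtains w where "\<And>v. \<phi> v = v \<bullet> w"
proof (cases "\<forall>v. \<phi> v = 0")
  case True
  then show thesis using that[of 0] by simp
next
  case False
  interpret bounded_linear \<phi> by fact
  define H where "H = {v. \<phi> v = 1}"
  obtain v0 where "\<phi> v0 \<noteq> 0" using False by blast
  then have "inverse (\<phi> v0) *\<^sub>R v0 \<in> H" by (simp add: H_def scale)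
  then have "H \<noteq> {}" by blast
  have "affine H"
    unfolding affine_def H_def by (simp add: add scale)
  have "closed H"
    unfolding H_def
    by (intro closed_Collect_eq continuous_on_const linear_continuous_on \<open>bounded_linear \<phi>\<close>)
  define p where "p = proj H 0"
  have "p \<in> H"
    unfolding p_def using \<open>affine H\<close> \<open>closed H\<close> \<open>H \<noteq> {}\<close> affine_imp_convex by (intro proj_in) auto
  have p1: "\<phi> p = 1" using \<open>p \<in> H\<close> by (simp add: H_def)
  then have pp: "p \<bullet> p \<noteq> 0" using zero by auto
  have "\<phi> v = v \<bullet> (inverse (p \<bullet> p) *\<^sub>R p)" for v
  proof -
    \<comment> \<open>The vector \<open>v - \<phi> v *\<^sub>R p\<close> lies in the kernel; adding
      \<open>p\<close> exhibits it as a direction of \<open>H\<close>.\<close>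
    have "v - \<phi> v *\<^sub>R p + p \<in> H"
      by (simp add: H_def add diff scale p1)
    then have "(0 - p) \<bullet> ((v - \<phi> v *\<^sub>R p + p) - p) = 0"
      unfolding p_def using \<open>affine H\<close> \<open>closed H\<close> \<open>p \<in> H\<close>
      by (intro proj_affine_orthogonal) (auto simp: p_def)
    then have "v \<bullet> p = \<phi> v * (p \<bullet> p)"
      by (simp add: inner_simps inner_commute)
    then show ?thesis using pp by simp
  qed
  then show thesis by (rule that)
qed

text \<open>As \<open>adjoint\<close> is defined by choice, it suffices that some map has the
  defining property; Riesz representation of \<open>x \<mapsto> A x \<bullet> y\<close> supplies
  one.\<close>

lemma adjoint_works_Hilbert:
  fixes A :: "'a::{real_inner, complete_space} \<Rightarrow> 'b::real_inner"
  assumes "bounded_linear A"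
  shows "x \<bullet> adjoint A y = A x \<bullet> y"
proof -
  have "\<exists>w. \<forall>x. A x \<bullet> y = x \<bullet> w" for y
  proof -
    have "bounded_linear (\<lambda>x. A x \<bullet> y)"
      using bounded_linear_compose[OF bounded_linear_inner_left assms] .
    then show ?thesis using Riesz_representation by metis
  qed
  then have "\<exists>f'. \<forall>x y. A x \<bullet> y = x \<bullet> f' y" by metis
  from someI_ex[OF this] show ?thesis
    unfolding adjoint_def by metis
qed

section \<open>Weak sequential compactness\<close>

text \<open>A subsequence is chosen whose inner products with every \<open>x j\<close> converge. The
  vectors \<open>v\<close> for which \<open>x (\<sigma> n) \<bullet> v\<close> converges form a
  closed subspace \<open>V\<close>, which turns out to be the whole space. The limits define a
  bounded functional, and its Riesz representative is the weak limit.\<close>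

lemma bounded_imp_weakly_convergent_subseq:
  fixes x :: "nat \<Rightarrow> 'a::{real_inner, complete_space}"
  assumes "bounded (range x)"
  obtains \<sigma> p where "strict_mono \<sigma>" "limitin weak_topology (x \<circ> \<sigma>) p sequentially"
proof -
  obtain B where "B > 0" and B: "\<And>n. norm (x n) \<le> B"
    using assms unfolding bounded_pos by auto
  have "norm (x n \<bullet> v) \<le> B * B" if "v \<in> range x" for n v
  proof -
    have "norm (x n \<bullet> v) \<le> norm (x n) * norm v"
      using Cauchy_Schwarz_ineq2[of "x n" v] by simp
    also have "\<dots> \<le> B * B"
      using that B \<open>B > 0\<close> by (auto intro!: mult_mono)
    finally show ?thesis .
  qed
  \<comment> \<open>Diagonal extraction: the vectors \<open>v\<close> are tested only on the
    countable set \<open>range x\<close>, with the uniform bound \<open>B * B\<close>.\<close>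
  then obtain \<sigma> :: "nat \<Rightarrow> nat" where "strict_mono \<sigma>"
    and \<sigma>: "\<And>v. v \<in> range x \<Longrightarrow> \<exists>l. (\<lambda>n. x (\<sigma> n) \<bullet> v) \<longlonglongrightarrow> l"
    by (rule function_convergent_subsequence[of "range x" "\<lambda>n v. x n \<bullet> v" "B * B", rotated]) auto
  define V where "V = {v. convergent (\<lambda>n. x (\<sigma> n) \<bullet> v)}"
  have range_V: "x j \<in> V" for j
    using \<sigma>[of "x j"] by (auto simp: V_def convergent_def)
  have "subspace V"
    unfolding subspace_def V_def
    by (auto simp: inner_add_right intro: convergent_const convergent_add convergent_mult)
  have "closed V"
  proof (subst closed_sequential_limits, safe)
    fix v l assume v: "\<forall>n. v n \<in> V" and l: "v \<longlonglongrightarrow> l"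
    have "Cauchy (\<lambda>n. x (\<sigma> n) \<bullet> l)"
    proof (rule metric_CauchyI)
      fix e :: real assume "0 < e"
      \<comment> \<open>An \<open>e / 3\<close> argument: replacing \<open>l\<close> by a close
        \<open>v j\<close> changes each inner product by less than \<open>e / 3\<close>, where
        \<open>B\<close> bounds the factor \<open>norm (x n)\<close>.\<close>
      then have "e / (3 * B) > 0" using \<open>B > 0\<close> by simp
      then obtain j where j: "dist (v j) l < e / (3 * B)"
        using l unfolding lim_sequentially by blast
      have near: "\<bar>x n \<bullet> (l - v j)\<bar> < e / 3" for n
      proof -
        have "\<bar>x n \<bullet> (l - v j)\<bar> \<le> norm (x n) * norm (l - v j)"
          by (rule Cauchy_Schwarz_ineq2)
        also have "\<dots> \<le> B * norm (l - v j)"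
          using B by (simp add: mult_right_mono)
        also have "\<dots> < B * (e / (3 * B))"
          using j \<open>B > 0\<close> by (intro mult_strict_left_mono) (auto simp: dist_norm norm_minus_commute)
        also have "\<dots> = e / 3" using \<open>B > 0\<close> by simp
        finally show ?thesis .
      qed
      have "Cauchy (\<lambda>n. x (\<sigma> n) \<bullet> v j)"
        using v by (simp add: V_def Cauchy_convergent_iff)
      then obtain M where M: "\<And>m n. m \<ge> M \<Longrightarrow> n \<ge> M \<Longrightarrow>
          dist (x (\<sigma> m) \<bullet> v j) (x (\<sigma> n) \<bullet> v j) < e / 3"
        using \<open>0 < e\<close> metric_CauchyD[of _ "e / 3"] by (metis divide_pos_pos zero_less_numeral)
      have "dist (x (\<sigma> m) \<bullet> l) (x (\<sigma> n) \<bullet> l) < e" if "m \<ge> M" "n \<ge> M" for m n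
        using M[OF that] near[of "\<sigma> m"] near[of "\<sigma> n"]
        unfolding dist_real_def inner_diff_right abs_less_iff by linarith
      then show "\<exists>M. \<forall>m\<ge>M. \<forall>n\<ge>M. dist (x (\<sigma> m) \<bullet> l) (x (\<sigma> n) \<bullet> l) < e"
        by blast
    qed
    then show "l \<in> V"
      by (simp add: V_def Cauchy_convergent_iff)
  qed
  have V_UNIV: "u \<in> V" for u
  proof -
    have V: "affine V" "V \<noteq> {}"
      using \<open>subspace V\<close> subspace_imp_affine range_V by auto
    \<comment> \<open>The part of \<open>u\<close> orthogonal to \<open>V\<close> is orthogonal to
      every \<open>x n\<close>, so its inner products are constantly zero and it belongs to
      \<open>V\<close> as well.\<close>
    have "x n \<bullet> (u - proj V u) = 0" for n
      using proj_affine_orthogonal[OF V(1) \<open>closed V\<close> range_V[of n] subspace_0[OF \<open>subspace V\<close>], of u]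
      by (simp add: inner_commute)
    then have "u - proj V u \<in> V"
      by (simp add: V_def convergent_const)
    moreover have "proj V u \<in> V"
      using V \<open>closed V\<close> affine_imp_convex by (intro proj_in) auto
    ultimately show ?thesis
      using subspace_add[OF \<open>subspace V\<close>] by fastforce
  qed
  define \<phi> where "\<phi> v = lim (\<lambda>n. x (\<sigma> n) \<bullet> v)" for v
  have \<phi>: "(\<lambda>n. x (\<sigma> n) \<bullet> v) \<longlonglongrightarrow> \<phi> v" for v
    using V_UNIV[of v] by (simp add: V_def \<phi>_def convergent_LIMSEQ_iff)
  have "bounded_linear \<phi>"
  proof (rule bounded_linear_intro)
    show "\<phi> (u + v) = \<phi> u + \<phi> v" for u v
      using \<phi>[of "u + v"] tendsto_add[OF \<phi>[of u] \<phi>[of v]]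
      by (auto simp: inner_add_right intro: LIMSEQ_unique)
    show "\<phi> (c *\<^sub>R v) = c *\<^sub>R \<phi> v" for c v
      using \<phi>[of "c *\<^sub>R v"] tendsto_mult_left[OF \<phi>[of v], of c]
      by (auto intro: LIMSEQ_unique)
    show "norm (\<phi> v) \<le> norm v * B" for v
    proof (rule LIMSEQ_le_const2[OF tendsto_norm[OF \<phi>]], intro exI allI impI)
      fix n
      have "norm (x (\<sigma> n) \<bullet> v) \<le> norm (x (\<sigma> n)) * norm v"
        using Cauchy_Schwarz_ineq2 by simp
      also have "\<dots> \<le> norm v * B"
        using mult_right_mono[OF B[of "\<sigma> n"], of "norm v"] by (simp add: mult.commute)
      finally show "norm (x (\<sigma> n) \<bullet> v) \<le> norm v * B" .
    qed
  qed
  then obtain p where "\<And>v. \<phi> v = v \<bullet> p"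
    using Riesz_representation by blast
  then have "limitin weak_topology (x \<circ> \<sigma>) p sequentially"
    using \<phi> by (simp add: limitin_weak_topology_iff inner_commute)
  with \<open>strict_mono \<sigma>\<close> show thesis by (rule that)
qed

text \<open>If some \<open>x k \<bullet> u\<close> did not tend to \<open>p \<bullet> u\<close>, a
  subsequence would keep a distance \<open>e\<close> from that value. By weak compactness it has a
  weakly convergent subsequence, whose limit is a cluster point and so equals \<open>p\<close>, a
  contradiction.\<close>

lemma weakly_convergent_if_unique_cluster_point:
  fixes x :: "nat \<Rightarrow> 'a::{real_inner, complete_space}"
  assumes "bounded (range x)" and unique: "\<And>q. weak_cluster_point x q \<Longrightarrow> q = p"
  shows "limitin weak_topology x p sequentially"
  unfolding limitin_weak_topology_iff
proof (rule allI, rule ccontr)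
  fix u assume "\<not> (\<lambda>k. x k \<bullet> u) \<longlonglongrightarrow> p \<bullet> u"
  then obtain e where "e > 0" and e: "\<And>N. \<exists>n\<ge>N. e \<le> dist (x n \<bullet> u) (p \<bullet> u)"
    unfolding lim_sequentially by (auto simp: not_less)
  then have "infinite {n. e \<le> dist (x n \<bullet> u) (p \<bullet> u)}"
    unfolding infinite_nat_iff_unbounded_le by auto
  then obtain \<rho> :: "nat \<Rightarrow> nat" where "strict_mono \<rho>"
    and \<rho>: "\<And>n. e \<le> dist (x (\<rho> n) \<bullet> u) (p \<bullet> u)"
    using infinite_enumerate by blast
  have "bounded (range (x \<circ> \<rho>))"
    using assms(1) by (rule bounded_subset) auto
  then obtain \<sigma> q where "strict_mono \<sigma>"
    and q: "limitin weak_topology (x \<circ> \<rho> \<circ> \<sigma>) q sequentially"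
    by (rule bounded_imp_weakly_convergent_subseq)
  have "weak_cluster_point x q"
    unfolding weak_cluster_point_def
    using strict_mono_o[OF \<open>strict_mono \<rho>\<close> \<open>strict_mono \<sigma>\<close>] q by (auto simp: o_assoc)
  then have "q = p" by (rule unique)
  then have "(\<lambda>n. x (\<rho> (\<sigma> n)) \<bullet> u) \<longlonglongrightarrow> p \<bullet> u"
    using q by (simp add: limitin_weak_topology_iff)
  then obtain n where "dist (x (\<rho> (\<sigma> n)) \<bullet> u) (p \<bullet> u) < e"
    using \<open>e > 0\<close> unfolding lim_sequentially by blast
  then show False using \<rho>[of "\<sigma> n"] by simp
qed

section \<open>Constrained least squares\<close>

lemma argmin_add_indicator_fun:
  assumes "U \<noteq> {}"
  shows "argmin (\<lambda>z. ereal (f z) + indicator_fun U z) = {z\<in>U. \<forall>u\<in>U. f z \<le> f u}"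
proof -
  obtain u0 where "u0 \<in> U" using assms by blast
  show ?thesis
  proof (rule set_eqI, rule iffI)
    fix z assume "z \<in> argmin (\<lambda>z. ereal (f z) + indicator_fun U z)"
    then have min: "ereal (f z) + indicator_fun U z \<le> ereal (f u) + indicator_fun U u" for u
      by (simp add: argmin_def)
    \<comment> \<open>The value at \<open>u0\<close> is finite, which rules out the value
      \<open>\<infinity>\<close> at a minimizer.\<close>
    have "z \<in> U"
      using min[of u0] \<open>u0 \<in> U\<close> by (auto simp: indicator_fun_def split: if_splits)
    moreover have "f z \<le> f u" if "u \<in> U" for u
      using min[of u] that \<open>z \<in> U\<close> by (simp add: indicator_fun_def)
    ultimately show "z \<in> {z\<in>U. \<forall>u\<in>U. f z \<le> f u}" by blast
  next
    fix z assume "z \<in> {z\<in>U. \<forall>u\<in>U. f z \<le> f u}"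
    then show "z \<in> argmin (\<lambda>z. ereal (f z) + indicator_fun U z)"
      by (auto simp: argmin_def indicator_fun_def)
  qed
qed

text \<open>The midpoint of two minimizers is feasible, so the parallelogram identity in the
  codomain forces their images under \<open>A\<close> to coincide. Conversely, on \<open>U\<close>
  the objective depends on a point only through its image.\<close>

lemma least_squares_argmin_eq_fibre:
  fixes A :: "'a::real_normed_vector \<Rightarrow> 'b::real_inner"
  assumes "linear A" "convex U" "U \<noteq> {}"
    and p: "p \<in> argmin (\<lambda>z. ereal (1/2 * (norm (A z - b))\<^sup>2) + indicator_fun U z)"
      (is "_ \<in> argmin ?F")
  shows "argmin ?F = {s\<in>U. A s = A p}"
proof -
  have eq: "argmin ?F = {z\<in>U. \<forall>u\<in>U. (norm (A z - b))\<^sup>2 \<le> (norm (A u - b))\<^sup>2}"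
    unfolding argmin_add_indicator_fun[OF \<open>U \<noteq> {}\<close>] by simp
  have "A s = A p" if s: "s \<in> argmin ?F" for s
  proof -
    define h where "h = (1/2) *\<^sub>R s + (1/2) *\<^sub>R p"
    have "h \<in> U"
      unfolding h_def using s p eq convexD[OF \<open>convex U\<close>, of s p "1/2" "1/2"] by simp
    then have "(norm (A s - b))\<^sup>2 \<le> (norm (A h - b))\<^sup>2" "(norm (A p - b))\<^sup>2 \<le> (norm (A h - b))\<^sup>2"
      using s p eq by auto
    moreover have "A h = (1/2) *\<^sub>R A s + (1/2) *\<^sub>R A p"
      using \<open>linear A\<close> by (simp add: h_def linear_add linear_scale)
    then have "(norm (A s - A p))\<^sup>2
        = 2 * (norm (A s - b))\<^sup>2 + 2 * (norm (A p - b))\<^sup>2 - 4 * (norm (A h - b))\<^sup>2"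
      unfolding power2_norm_eq_inner by (simp add: inner_simps inner_commute algebra_simps)
    ultimately have "(norm (A s - A p))\<^sup>2 \<le> 0" by linarith
    then show ?thesis by simp
  qed
  then have "argmin ?F \<subseteq> {s\<in>U. A s = A p}"
    using eq by blast
  moreover have "{s\<in>U. A s = A p} \<subseteq> argmin ?F"
    using p unfolding eq by auto
  ultimately show ?thesis by (rule equalityI)
qed

text \<open>The displacement is minus the sum of the projection residual, orthogonal to the
  directions of \<open>U\<close>, and a multiple of \<open>adjoint A y\<close>, orthogonal to the
  kernel of \<open>A\<close>.\<close>

lemma proj_gradient_step_orthogonal:
  fixes A :: "'a::{real_inner, complete_space} \<Rightarrow> 'b::real_inner"
  assumes "bounded_linear A" "affine U" "closed U" "u \<in> U" "v \<in> U" "A u = A v"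
  shows "(proj U (z - c *\<^sub>R adjoint A y) - z) \<bullet> (u - v) = 0"
proof -
  interpret bounded_linear A by fact
  define q where "q = z - c *\<^sub>R adjoint A y"
  have "(q - proj U q) \<bullet> (u - v) = 0"
    using assms by (intro proj_affine_orthogonal)
  moreover have "adjoint A y \<bullet> (u - v) = 0"
    using assms by (simp add: inner_commute[of _ "u - v"] adjoint_works_Hilbert diff)
  ultimately show ?thesis
    unfolding q_def[symmetric] by (simp add: q_def inner_diff_left)
qed

theorem theorem4p4:
  fixes A :: "'a::{real_inner, complete_space} \<Rightarrow> 'b::{real_inner, complete_space}"
    and b :: 'b and U S :: "'a set" and \<beta> :: real
    and f :: "'a \<Rightarrow> real" and g F :: "'a \<Rightarrow> ereal" and T :: "'a \<Rightarrow> 'a"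
    and t \<alpha> :: "nat \<Rightarrow> real" and x r :: "nat \<Rightarrow> 'a"
  assumes "bounded_linear A"
    and "affine U" and "closed U" and "U \<noteq> {}"
    and "f = (\<lambda>z. 1/2 * (norm (A z - b))\<^sup>2)"
    and "g = indicator_fun U"
    and "F = (\<lambda>z. ereal (f z) + g z)"
    and "S = argmin F"
    and "\<beta> = onorm (adjoint A \<circ> A)" and "\<beta> > 0"
    and "T = (\<lambda>z. proj U (z - (1/\<beta>) *\<^sub>R adjoint A (A z - b)))"
    and "S \<noteq> {}"
    and "\<And>k. t k > 0"
    and "\<And>k. \<alpha> k = (t k - 1) / t (Suc k)"
    and "r 0 = 0"
    and "\<And>k. x (Suc k) = T (x k + r k)"
    and "\<And>k. r (Suc k) = \<alpha> k *\<^sub>R (x (Suc k) - x k)"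
    and "bounded (range x)"
    and "\<And>p. weak_cluster_point x p \<Longrightarrow> p \<in> S"
  shows "limitin weak_topology x (proj S (x 0)) sequentially"
proof (rule weakly_convergent_if_unique_cluster_point)
  show "bounded (range x)" by fact
next
  fix p assume clus: "weak_cluster_point x p"
  then have "p \<in> S" by fact
  interpret A: bounded_linear A by fact
  \<comment> \<open>The cluster point \<open>p\<close> is itself a minimizer and serves as base
    point of the fibre.\<close>
  have S: "S = {s\<in>U. A s = A p}"
    using least_squares_argmin_eq_fibre[OF A.linear_axioms affine_imp_convex[OF \<open>affine U\<close>] \<open>U \<noteq> {}\<close>,
        of p b] \<open>p \<in> S\<close>
    unfolding \<open>S = argmin F\<close> \<open>F = _\<close> \<open>g = _\<close> \<open>f = _\<close> by simp
  have "affine S"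
    using \<open>affine U\<close> unfolding S affine_def
    by (auto simp: A.add A.scale scaleR_add_left[symmetric])
  have "closed {s. A s = A p}"
    by (intro closed_Collect_eq continuous_on_const linear_continuous_on \<open>bounded_linear A\<close>)
  then have "closed S"
    using closed_Int[OF \<open>closed U\<close>] unfolding S by (simp add: Collect_conj_eq)
  have "(x 0 - p) \<bullet> (s - p) = 0" if "s \<in> S" for s
  proof -
    have T: "(T z - z) \<bullet> (s - p) = 0" for z
      unfolding \<open>T = _\<close> using that \<open>p \<in> S\<close> S \<open>bounded_linear A\<close> \<open>affine U\<close> \<open>closed U\<close>
      by (intro proj_gradient_step_orthogonal) auto
    \<comment> \<open>The increment \<open>x (Suc k) - x k\<close> is \<open>T z - z\<close> at
      \<open>z = x k + r k\<close>, plus \<open>r k\<close>; both parts are orthogonal to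
      \<open>s - p\<close>.\<close>
    have r: "r k \<bullet> (s - p) = 0" for k
    proof (induction k)
      case 0
      show ?case by (simp add: \<open>r 0 = 0\<close>)
    next
      case (Suc k)
      then show ?case
        using T[of "x k + r k"] assms(16,17) by (simp add: inner_simps)
    qed
    have x: "x k \<bullet> (s - p) = x 0 \<bullet> (s - p)" for k
    proof (induction k)
      case (Suc k)
      then show ?case
        using T[of "x k + r k"] r[of k] assms(16) by (simp add: inner_simps)
    qed simp
    obtain \<sigma> where "limitin weak_topology (x \<circ> \<sigma>) p sequentially"
      using clus unfolding weak_cluster_point_def by blast
    then have "(\<lambda>k. x (\<sigma> k) \<bullet> (s - p)) \<longlonglongrightarrow> p \<bullet> (s - p)"
      by (simp add: limitin_weak_topology_iff)
    \<comment> \<open>By \<open>x\<close> the sequence of inner products is constant, so its weak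
      limit value equals the value at \<open>x 0\<close>.\<close>
    then have "x 0 \<bullet> (s - p) = p \<bullet> (s - p)"
      by (simp add: x[of "\<sigma> k" for k] LIMSEQ_const_iff)
    then show ?thesis
      by (simp add: inner_diff_left)
  qed
  then show "p = proj S (x 0)"
    using proj_affine_eqI[OF \<open>affine S\<close> \<open>closed S\<close> \<open>p \<in> S\<close>] by simp
qed

end
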